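(* Let $\mathrm{Err}$ be a good error function. Given $0<\epsilon<1/2$ and $0\le\eta<1/2$, there exists $C=C(\epsilon,\eta)>0$ such that for every $0<\theta\le1$ there is $N$ such that for all $n\ge N$ the following holds: for every $\mathbf{p},\mathbf{p}'\in[\epsilon,1-\epsilon]^n$ with $|p_i-p_i'|\ge\epsilon$ for all $i$, if $\bm\beta^*=(\beta_0,\dots,\beta_n)$ is the risk-minimizing linear solution of $(\mathbf{X},Y)$ for $(\mathbf{X},Y,Z)\sim\mathcal{D}^\eta_{\mathbf{p},\mathbf{p}'}$ and $\hat Y=\beta_0+\sum_{i=1}^n\beta_iX_i$, then $$\mathbb{P}_{(\mathbf{X},Y,Z)\sim\mathcal{D}^\eta_{\mathbf{p},\mathbf{p}'}}\Big[YZ=-1\ \Big|\ F\big(\mathrm{Err}(\hat Y,Y)\big)\ge1-\theta\Big]\ \ge\ \min\Big(1,\frac{\eta}{\theta}\Big)-\frac{C}{\sqrt n},$$ where $F$ is the CDF of $\mathrm{Err}(\hat Y,Y)$ under $\mathcal{D}^\eta_{\mathbf{p},\mathbf{p}'}$.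
   Context: A function $\mathrm{Err}:\mathbb{R}\times\{-1,1\}\to\mathbb{R}$ is a good error function if (1) for all $(\hat y_1,y_1),(\hat y_2,y_2)\in\mathbb{R}\times\{-1,1\}$ with $\hat y_1y_1>0$ and $\hat y_2y_2\le0$ we have $\mathrm{Err}(\hat y_1,y_1)<\mathrm{Err}(\hat y_2,y_2)$, and (2) for all $\hat y_1\ne\hat y_2$ and $y\in\{-1,1\}$, $\mathrm{Err}(\hat y_1,y)\ne\mathrm{Err}(\hat y_2,y)$. For $\mathbf{q}\in[0,1]^n$, $\mathcal{B}_{\mathbf{q}}$ is the law of independent $X_i\in\{-1,1\}$ with $\mathbb{P}[X_i=1]=q_i$. The toy distribution $\mathcal{D}^{\eta}_{\mathbf{p},\mathbf{p}'}$: sample $Z$ uniformly from $\{-1,1\}$; if $Z=1$ sample $\mathbf{X}\sim\mathcal{B}_{\mathbf{p}}$, else $\mathbf{X}\sim\mathcal{B}_{\mathbf{p}'}$; set $Y=Z$ with probability $1-\eta$ and $Y=-Z$ with probability $\eta$. The risk-minimizing linear solution is $\bm\beta^*=\arg\min_{\bm\beta}\mathbb{E}(\beta_0+\sum_i\beta_iX_i-Y)^2$. For a random variable $V$, $F(V)$ denotes its CDF $F_V(v)=\mathbb{P}[V\le v]$ evaluated at $V$. *)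

theory Defs
  imports "HOL-Analysis.Analysis"
begin

definition good_error_function :: "(real \<Rightarrow> real \<Rightarrow> real) \<Rightarrow> bool" where
  "good_error_function Err \<longleftrightarrow>
     (\<forall>yh1 y1 yh2 y2. y1 \<in> {-1, 1} \<longrightarrow> y2 \<in> {-1, 1} \<longrightarrow>
        yh1 * y1 > 0 \<longrightarrow> yh2 * y2 \<le> 0 \<longrightarrow> Err yh1 y1 < Err yh2 y2) \<and>
     (\<forall>yh1 yh2 y. y \<in> {-1, 1} \<longrightarrow> yh1 \<noteq> yh2 \<longrightarrow> Err yh1 y \<noteq> Err yh2 y)"

definition cube :: "nat \<Rightarrow> (nat \<Rightarrow> real) set" where
  "cube n = PiE {..<n} (\<lambda>_. {-1, 1})"

definition outcomes :: "nat \<Rightarrow> ((nat \<Rightarrow> real) \<times> real \<times> real) set" where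
  "outcomes n = cube n \<times> {-1, 1} \<times> {-1, 1}"

definition toy_pmf :: "nat \<Rightarrow> real \<Rightarrow> (nat \<Rightarrow> real) \<Rightarrow> (nat \<Rightarrow> real) \<Rightarrow>
    (nat \<Rightarrow> real) \<times> real \<times> real \<Rightarrow> real" where
  "toy_pmf n \<eta> p p' \<omega> = (case \<omega> of (x, y, z) \<Rightarrow>
     (1/2) * (\<Prod>i<n. let q = (if z = 1 then p i else p' i) in
                       if x i = 1 then q else 1 - q)
           * (if y = z then 1 - \<eta> else \<eta>))"

definition toy_prob :: "nat \<Rightarrow> real \<Rightarrow> (nat \<Rightarrow> real) \<Rightarrow> (nat \<Rightarrow> real) \<Rightarrow>
    ((nat \<Rightarrow> real) \<times> real \<times> real \<Rightarrow> bool) \<Rightarrow> real" where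
  "toy_prob n \<eta> p p' E = (\<Sum>\<omega>\<in>{\<omega>\<in>outcomes n. E \<omega>}. toy_pmf n \<eta> p p' \<omega>)"

definition toy_cond_prob :: "nat \<Rightarrow> real \<Rightarrow> (nat \<Rightarrow> real) \<Rightarrow> (nat \<Rightarrow> real) \<Rightarrow>
    ((nat \<Rightarrow> real) \<times> real \<times> real \<Rightarrow> bool) \<Rightarrow>
    ((nat \<Rightarrow> real) \<times> real \<times> real \<Rightarrow> bool) \<Rightarrow> real" where
  "toy_cond_prob n \<eta> p p' A B =
     toy_prob n \<eta> p p' (\<lambda>\<omega>. A \<omega> \<and> B \<omega>) / toy_prob n \<eta> p p' B"

text \<open>Linear predictor beta_0 + sum_{i} beta_i X_i (coefficients b 0..b (n-1)
correspond to beta_1..beta_n).\<close>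
definition lin_pred :: "nat \<Rightarrow> real \<Rightarrow> (nat \<Rightarrow> real) \<Rightarrow> (nat \<Rightarrow> real) \<Rightarrow> real" where
  "lin_pred n b0 b x = b0 + (\<Sum>i<n. b i * x i)"

definition toy_risk :: "nat \<Rightarrow> real \<Rightarrow> (nat \<Rightarrow> real) \<Rightarrow> (nat \<Rightarrow> real) \<Rightarrow>
    real \<Rightarrow> (nat \<Rightarrow> real) \<Rightarrow> real" where
  "toy_risk n \<eta> p p' b0 b =
     (\<Sum>\<omega>\<in>outcomes n. toy_pmf n \<eta> p p' \<omega> *
        (case \<omega> of (x, y, z) \<Rightarrow> (lin_pred n b0 b x - y)\<^sup>2))"

definition risk_minimizer :: "nat \<Rightarrow> real \<Rightarrow> (nat \<Rightarrow> real) \<Rightarrow> (nat \<Rightarrow> real) \<Rightarrow>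
    real \<Rightarrow> (nat \<Rightarrow> real) \<Rightarrow> bool" where
  "risk_minimizer n \<eta> p p' b0 b \<longleftrightarrow>
     (\<forall>c0 c. toy_risk n \<eta> p p' b0 b \<le> toy_risk n \<eta> p p' c0 c)"

definition toy_cdf :: "nat \<Rightarrow> real \<Rightarrow> (nat \<Rightarrow> real) \<Rightarrow> (nat \<Rightarrow> real) \<Rightarrow>
    ((nat \<Rightarrow> real) \<times> real \<times> real \<Rightarrow> real) \<Rightarrow> real \<Rightarrow> real" where
  "toy_cdf n \<eta> p p' V v = toy_prob n \<eta> p p' (\<lambda>\<omega>. V \<omega> \<le> v)"

end

(*
  The normal equations give b_i D_i = r (p_i - p'_i), where D_i is the average of the two
  conditional variances of X_i and r > 0. Hence the predictor Yh separates the two classes with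
  squared mean-to-variance ratio of order n, and by Chebyshev Yh Z <= 0 has probability O(1/n).
  Off that event the label-noise points YZ = -1 are exactly the points with Yh Y <= 0, which carry
  the largest errors; so the top quantile event either contains or is contained in them, up to
  O(1/n). Its mass exceeds theta by at most one atom of the error, and since every b_i is nonzero
  the atoms are O(1/sqrt n) by a Littlewood-Offord bound for biased signs.
  For theta < eta the quotient by theta is harmless because then the loss is measured against eta,
  so C depends on eta only through 1/eta, while for eta = 0 the claim is trivial.
*)

theory Submission
  imports Defs
begin

section \<open>Expectations under a product measure of biased signs\<close>

definition bexp :: "nat \<Rightarrow> (nat \<Rightarrow> real) \<Rightarrow> ((nat \<Rightarrow> real) \<Rightarrow> real) \<Rightarrow> real" where
  "bexp n q f = (\<Sum>x\<in>cube n. (\<Prod>i<n. if x i = 1 then q i else 1 - q i) * f x)"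

lemma finite_cube [simp]: "finite (cube n)"
  unfolding cube_def by (intro finite_PiE) auto

lemma bexp_0: "bexp 0 q f = f (\<lambda>_. undefined)"
  by (simp add: bexp_def cube_def)

text \<open>Conditioning on the last sign. This recursion turns each moment computation and the
  anticoncentration bound below into an induction on \<open>n\<close>.\<close>

lemma bexp_Suc:
  "bexp (Suc n) q f =
     q n * bexp n q (\<lambda>x. f (x(n := 1))) + (1 - q n) * bexp n q (\<lambda>x. f (x(n := -1)))"
proof -
  let ?w = "\<lambda>x. \<Prod>i<n. if x i = 1 then q i else 1 - q i"
  have inj: "inj_on (\<lambda>(y, g). g(n := y)) ({-1, 1::real} \<times> cube n)"
    unfolding cube_def by (rule inj_combinator) simp
  have w: "(\<Prod>i<n. if (x(n := s)) i = 1 then q i else 1 - q i) = ?w x" for x and s :: real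
    by (intro prod.cong) auto
  have "cube (Suc n) = (\<lambda>(y, g). g(n := y)) ` ({-1, 1} \<times> cube n)"
    unfolding cube_def lessThan_Suc by (rule PiE_insert_eq)
  then have "bexp (Suc n) q f = (\<Sum>(y, x)\<in>{-1, 1::real} \<times> cube n.
      (if y = 1 then q n else 1 - q n) * ?w x * f (x(n := y)))"
    unfolding bexp_def using inj
    by (simp add: sum.reindex case_prod_unfold w mult_ac del: fun_upd_apply) (simp add: mult_ac)
  also have "\<dots> = (\<Sum>y\<in>{-1, 1::real}. \<Sum>x\<in>cube n.
      (if y = 1 then q n else 1 - q n) * ?w x * f (x(n := y)))"
    by (simp add: sum.cartesian_product)
  finally show ?thesis
    by (simp add: bexp_def sum_distrib_left mult_ac)
qed

lemma bexp_cong: "(\<And>x. x \<in> cube n \<Longrightarrow> f x = g x) \<Longrightarrow> bexp n q f = bexp n q g"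
  by (simp add: bexp_def)

lemma bexp_add: "bexp n q (\<lambda>x. f x + g x) = bexp n q f + bexp n q g"
  by (simp add: bexp_def distrib_left sum.distrib)

lemma bexp_diff: "bexp n q (\<lambda>x. f x - g x) = bexp n q f - bexp n q g"
  by (simp add: bexp_def right_diff_distrib sum_subtractf)

lemma bexp_cmult: "bexp n q (\<lambda>x. c * f x) = c * bexp n q f"
  by (simp add: bexp_def sum_distrib_left mult_ac)

lemma bexp_const [simp]: "bexp n q (\<lambda>x. c) = c"
  by (induction n) (simp_all add: bexp_0 bexp_Suc algebra_simps)

lemma bexp_weight_nonneg:
  fixes q :: "nat \<Rightarrow> real"
  assumes "\<And>i. i < n \<Longrightarrow> 0 \<le> q i \<and> q i \<le> 1"
  shows "0 \<le> (\<Prod>i<n. if x i = 1 then q i else 1 - q i)"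
  using assms by (intro prod_nonneg) auto

lemma bexp_mono:
  assumes "\<And>i. i < n \<Longrightarrow> 0 \<le> q i \<and> q i \<le> 1" and "\<And>x. x \<in> cube n \<Longrightarrow> f x \<le> g x"
  shows "bexp n q f \<le> bexp n q g"
  unfolding bexp_def
  by (intro sum_mono mult_left_mono assms(2) bexp_weight_nonneg assms(1))

section \<open>First and second moments of a linear predictor\<close>

lemma lin_pred_Suc_upd [simp]:
  "lin_pred (Suc n) b0 b (x(n := s)) = lin_pred n b0 b x + b n * s"
proof -
  have "(\<Sum>i<n. b i * (x(n := s)) i) = (\<Sum>i<n. b i * x i)"
    by (intro sum.cong) auto
  then show ?thesis by (simp add: lin_pred_def)
qed

lemma bexp_lin_pred:
  "bexp n q (lin_pred n b0 b) = b0 + (\<Sum>i<n. b i * (2 * q i - 1))"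
proof (induction n)
  case 0
  then show ?case by (simp add: bexp_0 lin_pred_def)
next
  case (Suc n)
  then show ?case by (simp add: bexp_Suc bexp_add bexp_diff) (simp add: algebra_simps)
qed

lemma bexp_coord:
  assumes "i < n"
  shows "bexp n q (\<lambda>x. x i) = 2 * q i - 1"
  using assms
proof (induction n)
  case (Suc n)
  then show ?case by (cases "i = n") (simp_all add: bexp_Suc algebra_simps)
qed simp

text \<open>By independence only the term \<open>b i * x i\<close> correlates with
  \<open>x i\<close>; the sign \<open>x i\<close> has square 1 and mean \<open>2 * q i - 1\<close>,
  hence variance \<open>1 - (2 * q i - 1)\<^sup>2\<close>.\<close>

lemma bexp_lin_pred_coord:
  assumes "i < n"
  shows "bexp n q (\<lambda>x. lin_pred n b0 b x * x i) =
    bexp n q (lin_pred n b0 b) * (2 * q i - 1) + b i * (1 - (2 * q i - 1)\<^sup>2)"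
  using assms
proof (induction n)
  case (Suc n)
  show ?case
  proof (cases "i = n")
    case True
    have "bexp n q (\<lambda>x. - lin_pred n b0 b x) = - bexp n q (lin_pred n b0 b)"
      using bexp_cmult[of n q "-1"] by simp
    then show ?thesis using True
      by (simp add: bexp_Suc bexp_add bexp_diff algebra_simps power2_eq_square)
  next
    case False
    then have "i < n" using Suc by simp
    have *: "bexp n q (\<lambda>x. (lin_pred n b0 b x + c) * x i) =
       bexp n q (\<lambda>x. lin_pred n b0 b x * x i) + c * (2 * q i - 1)" for c
      using \<open>i < n\<close> by (simp add: distrib_right bexp_add bexp_cmult bexp_coord)
    show ?thesis using False Suc.IH[OF \<open>i < n\<close>] *[of "b n"] *[of "- b n"]
      by (simp add: bexp_Suc bexp_add) (simp add: algebra_simps bexp_diff)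
  qed
qed simp

lemma bexp_square_shift:
  "bexp n q (\<lambda>x. (f x + c)\<^sup>2) = bexp n q (\<lambda>x. (f x)\<^sup>2) + 2 * c * bexp n q f + c\<^sup>2"
proof -
  have "bexp n q (\<lambda>x. (f x + c)\<^sup>2) = bexp n q (\<lambda>x. ((f x)\<^sup>2 + (2 * c) * f x) + c\<^sup>2)"
    by (rule bexp_cong) (simp add: power2_eq_square algebra_simps)
  then show ?thesis by (simp only: bexp_add bexp_cmult bexp_const)
qed

text \<open>Squared mean plus variance, where the variances of the independent terms
  \<open>b i * x i\<close> add up.\<close>

lemma bexp_lin_pred_square:
  "bexp n q (\<lambda>x. (lin_pred n b0 b x)\<^sup>2) =
    (bexp n q (lin_pred n b0 b))\<^sup>2 + (\<Sum>i<n. (b i)\<^sup>2 * (1 - (2 * q i - 1)\<^sup>2))"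
proof (induction n)
  case 0
  then show ?case by (simp add: bexp_0)
next
  case (Suc n)
  then show ?case
    using bexp_square_shift[of n q "lin_pred n b0 b" "b n"]
      bexp_square_shift[of n q "lin_pred n b0 b" "- b n"]
    by (simp add: bexp_Suc bexp_add bexp_diff) (simp add: algebra_simps power2_eq_square)
qed

lemma bexp_lin_pred_variance:
  "bexp n q (\<lambda>x. (lin_pred n b0 b x - bexp n q (lin_pred n b0 b))\<^sup>2) =
    (\<Sum>i<n. (b i)\<^sup>2 * (1 - (2 * q i - 1)\<^sup>2))"
  using bexp_square_shift[of n q "lin_pred n b0 b" "- bexp n q (lin_pred n b0 b)"]
  by (simp add: bexp_lin_pred_square mult.assoc flip: power2_eq_square)

text \<open>Here \<open>s\<close> is the class sign and \<open>e\<close> the mean of the predictor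
  measured in that direction. A wrong or zero sign forces a deviation of at least \<open>e\<close>
  from the mean, so Chebyshev's inequality applies.\<close>

lemma chebyshev_sign:
  assumes q: "\<And>i. i < n \<Longrightarrow> 0 \<le> q i \<and> q i \<le> 1"
    and e: "s * bexp n q (lin_pred n b0 b) = e" "0 < e" and s: "s\<^sup>2 = 1"
  shows "bexp n q (\<lambda>x. of_bool (lin_pred n b0 b x * s \<le> 0)) \<le>
    (\<Sum>i<n. (b i)\<^sup>2 * (1 - (2 * q i - 1)\<^sup>2)) / e\<^sup>2"
proof -
  let ?m = "bexp n q (lin_pred n b0 b)"
  have "of_bool (lin_pred n b0 b x * s \<le> 0) \<le> (1 / e\<^sup>2) * (lin_pred n b0 b x - ?m)\<^sup>2" for x
  proof (cases "lin_pred n b0 b x * s \<le> 0")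
    case True
    then have "e \<le> e - lin_pred n b0 b x * s" by simp
    then have "e\<^sup>2 \<le> (e - lin_pred n b0 b x * s)\<^sup>2"
      using e(2) by (intro power_mono) auto
    also have "\<dots> = s\<^sup>2 * (lin_pred n b0 b x - ?m)\<^sup>2"
      unfolding e(1)[symmetric] by (simp add: power2_eq_square algebra_simps)
    finally show ?thesis using True e(2) s by (simp add: field_simps)
  qed simp
  then have "bexp n q (\<lambda>x. of_bool (lin_pred n b0 b x * s \<le> 0)) \<le>
      bexp n q (\<lambda>x. (1 / e\<^sup>2) * (lin_pred n b0 b x - ?m)\<^sup>2)"
    by (intro bexp_mono q)
  then show ?thesis by (simp only: bexp_cmult bexp_lin_pred_variance) simp
qed

section \<open>Anticoncentration: a Littlewood-Offord bound for biased signs\<close>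

text \<open>A finite set containing its translate would equal it by cardinality, but translation
  changes the sum of the elements by \<open>d\<close> times their number.\<close>

lemma translate_not_subset:
  fixes A :: "real set"
  assumes "finite A" "A \<noteq> {}" "d \<noteq> 0"
  shows "\<exists>a\<in>A. a + d \<notin> A"
proof (rule ccontr)
  assume "\<not> ?thesis"
  then have "(\<lambda>a. a + d) ` A \<subseteq> A" by auto
  then have "(\<lambda>a. a + d) ` A = A"
    using assms(1) by (intro card_subset_eq) (auto simp: card_image)
  then have "\<Sum>A = (\<Sum>a\<in>A. a + d)"
    by (metis (no_types, lifting) add_right_cancel inj_onI sum.reindex_cong)
  then show False using assms by (simp add: sum.distrib)
qed

text \<open>The function \<open>k / (k + \<tau>)\<close> with \<open>\<tau> \<propto> sqrt (n + 1)\<close> is a supersolution of the lazy random walk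
  equation in the region \<open>k \<le> \<tau>\<close>; beyond it the truncation at 1 in \<open>lo_bound\<close> takes over.\<close>
lemma supersolution_step:
  fixes \<tau> \<tau>' q \<epsilon> k :: real
  assumes k: "1 \<le> k" and \<tau>: "0 < \<tau>" "\<tau> \<le> \<tau>'" "\<tau>' \<le> 2 * \<tau>"
    and sq: "\<tau>'\<^sup>2 = \<tau>\<^sup>2 + \<epsilon> / 2" and q: "\<epsilon> \<le> q" and \<epsilon>: "0 < \<epsilon>" and small: "k \<le> \<tau>'"
  shows "q * ((k + 1) / (k + 1 + \<tau>) + (k - 1) / (k - 1 + \<tau>)) + (1 - 2 * q) * (k / (k + \<tau>))
    \<le> k / (k + \<tau>')"
proof -
  \<comment> \<open>Writing each fraction as 1 minus \<open>\<tau>\<close> over a shift of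
    \<open>K\<close> reduces the averaging to a second difference of the reciprocal, which is at
    least \<open>2 / K ^ 3\<close>.\<close>
  define K where "K = k + \<tau>"
  have K: "K > 1" using k \<tau> by (simp add: K_def)
  have K2: "K * (K\<^sup>2 - 1) > 0" using K by simp
  have a1: "(k + 1) / (k + 1 + \<tau>) = 1 - \<tau> / (K + 1)" "(k - 1) / (k - 1 + \<tau>) = 1 - \<tau> / (K - 1)"
    "k / (k + \<tau>) = 1 - \<tau> / K"
    using K k \<tau> by (simp_all add: K_def field_simps)
  have a2: "1 / (K + 1) + 1 / (K - 1) - 2 / K = 2 / (K * (K\<^sup>2 - 1))"
    using K K2 by (simp add: divide_simps power2_eq_square) (simp add: algebra_simps)
  have "q * ((k + 1) / (k + 1 + \<tau>) + (k - 1) / (k - 1 + \<tau>)) + (1 - 2 * q) * (k / (k + \<tau>))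
     = k / K - q * \<tau> * (1 / (K + 1) + 1 / (K - 1) - 2 / K)"
    unfolding a1 using a1(3) by (simp add: K_def algebra_simps)
  also have "\<dots> = k / K - q * (2 * \<tau> / (K * (K\<^sup>2 - 1)))" unfolding a2 by simp
  also have "\<dots> \<le> k / K - \<epsilon> * (2 * \<tau> / K ^ 3)"
  proof -
    have "2 * \<tau> / K ^ 3 \<le> 2 * \<tau> / (K * (K\<^sup>2 - 1))"
      using K K2 \<tau> by (intro divide_left_mono) (auto simp: power3_eq_cube power2_eq_square algebra_simps)
    then have "\<epsilon> * (2 * \<tau> / K ^ 3) \<le> q * (2 * \<tau> / (K * (K\<^sup>2 - 1)))"
      using q \<epsilon> \<tau> K by (intro mult_mono) auto
    then show ?thesis by simp
  qed
  \<comment> \<open>The gain \<open>2 * \<epsilon> * \<tau> / K ^ 3\<close> from convexity pays for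
    raising \<tau> to \<tau>'. Since \<open>k \<le> 2 * \<tau>\<close>,
    \<open>K \<le> 3 * \<tau>\<close> and \<tau>' exceeds \<tau> by at most
    \<open>\<epsilon> / (4 * \<tau>)\<close>, the cost is at most three quarters of that
    gain.\<close>
  also have "\<dots> \<le> k / (k + \<tau>')"
  proof -
    have d: "\<tau>' - \<tau> \<le> \<epsilon> / (4 * \<tau>)"
    proof -
      have "(\<tau>' - \<tau>) * (2 * \<tau>) \<le> (\<tau>' - \<tau>) * (\<tau>' + \<tau>)"
        using \<tau> by (intro mult_left_mono) auto
      also have "\<dots> = \<epsilon> / 2" using sq by (simp add: power2_eq_square algebra_simps)
      finally show ?thesis using \<tau> by (simp add: field_simps)
    qed
    have kK: "k * K \<le> 2 * \<tau> * (3 * \<tau>)"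
      using k \<tau> small by (intro mult_mono) (auto simp: K_def)
    have "k / K - k / (k + \<tau>') = k * (\<tau>' - \<tau>) / (K * (k + \<tau>'))"
      using K k \<tau> by (simp add: K_def field_simps)
    also have "\<dots> \<le> k * (\<tau>' - \<tau>) / (K * K)"
      using K k \<tau> by (intro divide_left_mono mult_left_mono) (auto simp: K_def)
    also have "\<dots> = (k * K) * (\<tau>' - \<tau>) / K ^ 3"
      using K by (simp add: power3_eq_cube)
    also have "\<dots> \<le> (2 * \<tau> * (3 * \<tau>)) * (\<epsilon> / (4 * \<tau>)) / K ^ 3"
      using K k \<tau> \<epsilon> by (intro divide_right_mono mult_mono kK d) auto
    also have "\<dots> \<le> \<epsilon> * (2 * \<tau> / K ^ 3)"
      using K \<tau> \<epsilon> by (simp add: field_simps)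
    finally show ?thesis by simp
  qed
  finally show ?thesis .
qed

text \<open>The factor 2 makes the fraction reach 1 exactly when \<open>k\<close> equals the square
  root, so for larger \<open>k\<close> the bound is trivial. The shift \<open>n + 1\<close> keeps
  the root positive at \<open>n = 0\<close>.\<close>

definition lo_bound :: "real \<Rightarrow> nat \<Rightarrow> nat \<Rightarrow> real" where
  "lo_bound \<epsilon> n k = min 1 (2 * real k / (real k + sqrt (\<epsilon> / 2 * (real n + 1))))"

text \<open>One step of a lazy walk that moves to either neighbour with probability
  \<open>q\<close>. Up to the new root this is the supersolution inequality; beyond it the
  right-hand side is 1, which bounds any average of truncated values.\<close>

lemma lo_bound_Suc:
  assumes \<epsilon>: "0 < \<epsilon>" and q: "\<epsilon> \<le> q" "q \<le> 1 / 2" and k: "1 \<le> k"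
  shows "q * (lo_bound \<epsilon> n (k + 1) + lo_bound \<epsilon> n (k - 1)) + (1 - 2 * q) * lo_bound \<epsilon> n k
    \<le> lo_bound \<epsilon> (Suc n) k" (is "?L \<le> _")
proof -
  define \<tau> where "\<tau> = sqrt (\<epsilon> / 2 * (real n + 1))"
  define \<tau>' where "\<tau>' = sqrt (\<epsilon> / 2 * (real (Suc n) + 1))"
  let ?u = "\<lambda>j::real. j / (j + \<tau>)"
  have \<tau>: "0 < \<tau>" "\<tau> \<le> \<tau>'" using \<epsilon> by (simp_all add: \<tau>_def \<tau>'_def)
  have "\<tau>' \<le> sqrt (2\<^sup>2 * (\<epsilon> / 2 * (real n + 1)))"
    unfolding \<tau>'_def using \<epsilon> by (intro real_sqrt_le_mono) (simp add: field_simps)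
  moreover have "sqrt (2\<^sup>2 * r) = 2 * sqrt r" for r :: real by (simp add: real_sqrt_mult)
  ultimately have \<tau>2: "\<tau>' \<le> 2 * \<tau>" by (simp only: \<tau>_def)
  have sq: "\<tau>'\<^sup>2 = \<tau>\<^sup>2 + \<epsilon> / 2"
    using \<epsilon> by (simp add: \<tau>_def \<tau>'_def field_simps)
  have nn: "0 \<le> q" "0 \<le> 1 - 2 * q" using q \<epsilon> by auto
  have one: "lo_bound \<epsilon> n j \<le> 1" and two: "lo_bound \<epsilon> n j \<le> 2 * ?u j" for j
    by (auto simp: lo_bound_def \<tau>_def)
  have "?L \<le> q * (1 + 1) + (1 - 2 * q) * 1"
    by (intro add_mono mult_left_mono one nn)
  then have L1: "?L \<le> 1" by simp
  show ?thesis
  proof (cases "real k \<le> \<tau>'")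
    case True
    have "?L \<le> q * (2 * ?u (k + 1) + 2 * ?u (k - 1)) + (1 - 2 * q) * (2 * ?u k)"
      by (intro add_mono mult_left_mono two nn)
    also have "\<dots> = 2 * (q * ((real k + 1) / (real k + 1 + \<tau>) + (real k - 1) / (real k - 1 + \<tau>))
        + (1 - 2 * q) * (real k / (real k + \<tau>)))"
      using k by (simp add: algebra_simps)
    also have "\<dots> \<le> 2 * (real k / (real k + \<tau>'))"
      using k by (intro mult_left_mono supersolution_step[OF _ \<tau> \<tau>2 sq q(1) \<epsilon> True]) auto
    finally show ?thesis using L1 by (simp add: lo_bound_def \<tau>'_def)
  next
    case False
    then have "1 \<le> 2 * real k / (real k + \<tau>')" using \<tau> by (simp add: field_simps)
    then show ?thesis using L1 by (simp add: lo_bound_def \<tau>'_def)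
  qed
qed

lemma bexp_of_bool_insert:
  assumes "m \<notin> A"
  shows "bexp n q (\<lambda>x. of_bool (f x \<in> insert m A)) =
    bexp n q (\<lambda>x. of_bool (f x = m)) + bexp n q (\<lambda>x. of_bool (f x \<in> A))"
  unfolding bexp_add[symmetric] using assms by (intro bexp_cong) auto

text \<open>Generalising from a point to a finite set \<open>T\<close> makes the induction work: conditioning on the
  last sign gives the translates \<open>T - b n\<close> and \<open>T + b n\<close>, and moving one point from the second to
  the first turns the sizes \<open>(k, k)\<close> into \<open>(k + 1, k - 1)\<close>.\<close>
lemma littlewood_offord:
  assumes \<epsilon>: "0 < \<epsilon>" "\<epsilon> \<le> 1"
    and q: "\<And>i. i < n \<Longrightarrow> \<epsilon> \<le> q i \<and> q i \<le> 1 - \<epsilon>"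
    and b: "\<And>i. i < n \<Longrightarrow> b i \<noteq> 0" and T: "finite T"
  shows "bexp n q (\<lambda>x. of_bool (lin_pred n b0 b x \<in> T)) \<le> lo_bound \<epsilon> n (card T)"
  using q b T
proof (induction n arbitrary: T)
  case 0
  show ?case
  proof (cases "T = {}")
    case False
    \<comment> \<open>With no signs left the probability may be 1, so the bound has to be 1 as soon
      as \<open>T\<close> has a point; this holds because the root is at most 1.\<close>
    then have "real (card T) \<ge> 1" using 0 by (simp add: Suc_le_eq card_gt_0_iff)
    moreover have "sqrt (\<epsilon> / 2) \<le> 1" "sqrt (\<epsilon> / 2) > 0" using \<epsilon> by auto
    ultimately have "0 < real (card T) + sqrt (\<epsilon> / 2)"
      "real (card T) + sqrt (\<epsilon> / 2) \<le> 2 * real (card T)" by linarith+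
    then have "1 \<le> 2 * real (card T) / (real (card T) + sqrt (\<epsilon> / 2))"
      by (simp only: pos_le_divide_eq mult_1)
    then have "lo_bound \<epsilon> 0 (card T) = 1"
      by (simp add: lo_bound_def)
    then show ?thesis by (simp add: bexp_0)
  qed (simp add: bexp_0 lo_bound_def)
next
  case (Suc n)
  show ?case
  proof (cases "T = {}")
    case True
    then show ?thesis using \<epsilon> by (simp add: lo_bound_def)
  next
    case False
    define P where "P = (\<lambda>T. bexp n q (\<lambda>x. of_bool (lin_pred n b0 b x \<in> T)))"
    define A where "A = (\<lambda>t. t - b n) ` T"
    define B where "B = (\<lambda>t. t + b n) ` T"
    define k where "k = card T"
    have k: "1 \<le> k" using False Suc.prems by (simp add: k_def Suc_le_eq card_gt_0_iff)
    have fin: "finite A" "finite B" using Suc.prems by (auto simp: A_def B_def)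
    have card: "card A = k" "card B = k"
      by (auto simp: A_def B_def k_def card_image inj_on_def)
    have IH: "P S \<le> lo_bound \<epsilon> n (card S)" if "finite S" for S
      unfolding P_def using that Suc.prems by (intro Suc.IH) auto
    \<comment> \<open>\<open>B\<close> is the translate of \<open>A\<close> by
      \<open>2 * b n\<close>, which is nonzero, so some point of \<open>B\<close> lies outside
      \<open>A\<close>.\<close>
    have "\<exists>a\<in>A. a + 2 * b n \<notin> A"
      using False Suc.prems fin by (intro translate_not_subset) (auto simp: A_def)
    then obtain m where m: "m \<in> B" "m \<notin> A" by (force simp: A_def B_def)
    have "P (insert m A) = P {m} + P A"
      unfolding P_def using bexp_of_bool_insert[OF m(2)] by simp
    moreover have "P B = P {m} + P (B - {m})"
      unfolding P_def using bexp_of_bool_insert[of m "B - {m}"] m(1)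
      by (simp add: insert_absorb)
    ultimately have "P A + P B = P (insert m A) + P (B - {m})" by simp
    also have "\<dots> \<le> lo_bound \<epsilon> n (card (insert m A)) + lo_bound \<epsilon> n (card (B - {m}))"
      using fin by (intro add_mono IH) auto
    also have "\<dots> = lo_bound \<epsilon> n (k + 1) + lo_bound \<epsilon> n (k - 1)"
      using fin m card by simp
    finally have sum: "P A + P B \<le> lo_bound \<epsilon> n (k + 1) + lo_bound \<epsilon> n (k - 1)" .
    have PA: "P A \<le> lo_bound \<epsilon> n k" and PB: "P B \<le> lo_bound \<epsilon> n k"
      using IH[OF fin(1)] IH[OF fin(2)] card by auto
    \<comment> \<open>The biased sign becomes a lazy symmetric step: both sides receive weight
      \<open>r\<close>, and the surplus \<open>1 - 2 * r\<close> falls on one side, where the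
      induction hypothesis at size \<open>k\<close> is used.\<close>
    define r where "r = min (q n) (1 - q n)"
    have r: "\<epsilon> \<le> r" "r \<le> 1 / 2" using Suc.prems(1)[of n] by (auto simp: r_def min_def)
    have "(lin_pred n b0 b x + b n \<in> T) = (lin_pred n b0 b x \<in> A)"
      "(lin_pred n b0 b x - b n \<in> T) = (lin_pred n b0 b x \<in> B)" for x
      by (force simp: A_def B_def)+
    then have "bexp (Suc n) q (\<lambda>x. of_bool (lin_pred (Suc n) b0 b x \<in> T))
        = q n * P A + (1 - q n) * P B"
      by (simp add: bexp_Suc P_def)
    also have "\<dots> \<le> r * (P A + P B) + (1 - 2 * r) * lo_bound \<epsilon> n k"
    proof (cases "q n \<le> 1 / 2")
      case True
      then have "(1 - 2 * q n) * P B \<le> (1 - 2 * q n) * lo_bound \<epsilon> n k"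
        by (intro mult_left_mono PB) auto
      then show ?thesis using True by (simp add: r_def min_def algebra_simps)
    next
      case False
      then have "(2 * q n - 1) * P A \<le> (2 * q n - 1) * lo_bound \<epsilon> n k"
        by (intro mult_left_mono PA) auto
      then show ?thesis using False by (simp add: r_def min_def algebra_simps)
    qed
    also have "\<dots> \<le> r * (lo_bound \<epsilon> n (k + 1) + lo_bound \<epsilon> n (k - 1))
        + (1 - 2 * r) * lo_bound \<epsilon> n k"
      using r \<epsilon> sum by (intro add_right_mono mult_left_mono) auto
    also have "\<dots> \<le> lo_bound \<epsilon> (Suc n) k"
      by (rule lo_bound_Suc[OF \<epsilon>(1) r k])
    finally show ?thesis by (simp add: k_def)
  qed
qed

text \<open>The case of a one-point set, with the truncation and the 1 in the denominator
  dropped.\<close>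

lemma littlewood_offord_point:
  assumes \<epsilon>: "0 < \<epsilon>" "\<epsilon> \<le> 1" and n: "0 < n"
    and q: "\<And>i. i < n \<Longrightarrow> \<epsilon> \<le> q i \<and> q i \<le> 1 - \<epsilon>"
    and b: "\<And>i. i < n \<Longrightarrow> b i \<noteq> 0"
  shows "bexp n q (\<lambda>x. of_bool (lin_pred n b0 b x = a)) \<le> 2 / sqrt (\<epsilon> / 2) / sqrt (real n)"
proof -
  have "bexp n q (\<lambda>x. of_bool (lin_pred n b0 b x \<in> {a})) \<le> lo_bound \<epsilon> n (card {a})"
    by (rule littlewood_offord) (use assms in auto)
  also have "\<dots> \<le> 2 / (1 + sqrt (\<epsilon> / 2 * (real n + 1)))"
    by (simp add: lo_bound_def)
  also have "\<dots> \<le> 2 / sqrt (\<epsilon> / 2 * real n)"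
  proof (intro divide_left_mono)
    have "sqrt (\<epsilon> / 2 * real n) \<le> sqrt (\<epsilon> / 2 * (real n + 1))"
      using \<epsilon> by (intro real_sqrt_le_mono mult_left_mono) auto
    then show "sqrt (\<epsilon> / 2 * real n) \<le> 1 + sqrt (\<epsilon> / 2 * (real n + 1))" by (rule order_trans) simp
    have "0 < sqrt (\<epsilon> / 2 * (real n + 1))" "0 < sqrt (\<epsilon> / 2 * real n)" using \<epsilon> n by auto
    then show "0 < (1 + sqrt (\<epsilon> / 2 * (real n + 1))) * sqrt (\<epsilon> / 2 * real n)"
      by (intro mult_pos_pos add_pos_pos) auto
  qed auto
  finally show ?thesis by (simp add: real_sqrt_mult real_sqrt_divide)
qed

section \<open>Top quantile events in a finite probability space\<close>

text \<open>Lower bound: the complement of \<open>B\<close> lies below its own largest value, whose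
  CDF is under \<open>1 - \<theta>\<close>. Upper bound: the CDF at the smallest value on
  \<open>B\<close> is at least \<open>1 - \<theta>\<close>, so \<open>B\<close> has mass at most
  \<theta> strictly above that value, plus one atom.\<close>

lemma quantile_event_bounds:
  fixes w V :: "'a \<Rightarrow> real"
  assumes fin: "finite \<Omega>" and w: "\<And>\<omega>. \<omega> \<in> \<Omega> \<Longrightarrow> 0 \<le> w \<omega>" "sum w \<Omega> = 1"
    and \<theta>: "0 < \<theta>" "\<theta> \<le> 1"
    and atom: "\<And>v. sum w {\<omega>\<in>\<Omega>. V \<omega> = v} \<le> a"
    and B: "B = {\<omega>\<in>\<Omega>. 1 - \<theta> \<le> sum w {\<omega>'\<in>\<Omega>. V \<omega>' \<le> V \<omega>}}"
  shows "\<theta> \<le> sum w B" and "sum w B \<le> \<theta> + a"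
proof -
  have BO: "B \<subseteq> \<Omega>" using B by auto
  have finB: "finite B" using fin BO by (rule finite_subset[rotated])
  have mono: "sum w S \<le> sum w T" if "S \<subseteq> T" "T \<subseteq> \<Omega>" for S T
    using that w fin by (intro sum_mono2) (auto intro: finite_subset)
  have compl: "sum w (\<Omega> - S) = 1 - sum w S" if "S \<subseteq> \<Omega>" for S
    using that w fin by (simp add: sum_diff)
  show lower: "\<theta> \<le> sum w B"
  proof (cases "\<Omega> - B = {}")
    case True
    then have "B = \<Omega>" using BO by auto
    then show ?thesis using w \<theta> by simp
  next
    case False
    define v where "v = Max (V ` (\<Omega> - B))"
    have "v \<in> V ` (\<Omega> - B)" unfolding v_def using fin False by (intro Max_in) auto
    then obtain \<omega> where \<omega>: "\<omega> \<in> \<Omega>" "\<omega> \<notin> B" "v = V \<omega>" by auto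
    have "\<Omega> - B \<subseteq> {\<omega>'\<in>\<Omega>. V \<omega>' \<le> v}" unfolding v_def using fin by auto
    then have "sum w (\<Omega> - B) \<le> sum w {\<omega>'\<in>\<Omega>. V \<omega>' \<le> v}" by (rule mono) auto
    also have "\<dots> < 1 - \<theta>" using \<omega> B by auto
    finally show ?thesis using compl[OF BO] by simp
  qed
  have "B \<noteq> {}" using lower \<theta> by auto
  define v where "v = Min (V ` B)"
  have "v \<in> V ` B" unfolding v_def using finB \<open>B \<noteq> {}\<close> by (intro Min_in) auto
  then have F: "1 - \<theta> \<le> sum w {\<omega>'\<in>\<Omega>. V \<omega>' \<le> v}" using B by auto
  have "v \<le> V \<omega>" if "\<omega> \<in> B" for \<omega> unfolding v_def using finB that by auto
  then have "B \<subseteq> (\<Omega> - {\<omega>'\<in>\<Omega>. V \<omega>' \<le> v}) \<union> {\<omega>'\<in>\<Omega>. V \<omega>' = v}"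
    using BO by force
  then have "sum w B \<le> sum w ((\<Omega> - {\<omega>'\<in>\<Omega>. V \<omega>' \<le> v}) \<union> {\<omega>'\<in>\<Omega>. V \<omega>' = v})"
    by (rule mono) auto
  also have "\<dots> = sum w (\<Omega> - {\<omega>'\<in>\<Omega>. V \<omega>' \<le> v}) + sum w {\<omega>'\<in>\<Omega>. V \<omega>' = v}"
    using fin by (intro sum.union_disjoint) auto
  also have "\<dots> \<le> \<theta> + a" using compl[of "{\<omega>'\<in>\<Omega>. V \<omega>' \<le> v}"] F atom[of v] by simp
  finally show "sum w B \<le> \<theta> + a" .
qed

text \<open>In the application \<open>M\<close> is the label noise and \<open>W\<close> the set of
  wrong predictions, which carry the largest errors. The atom loss is divided by \<eta> only, so it
  yields a constant free of \<theta>; the loss \<delta> is of lower order and can afford the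
  division by \<theta>.\<close>

lemma quantile_event_ratio:
  fixes w V :: "'a \<Rightarrow> real"
  assumes fin: "finite \<Omega>" and w: "\<And>\<omega>. \<omega> \<in> \<Omega> \<Longrightarrow> 0 \<le> w \<omega>" "sum w \<Omega> = 1"
    and \<theta>: "0 < \<theta>" "\<theta> \<le> 1"
    and atom: "\<And>v. sum w {\<omega>\<in>\<Omega>. V \<omega> = v} \<le> a"
    and B: "B = {\<omega>\<in>\<Omega>. 1 - \<theta> \<le> sum w {\<omega>'\<in>\<Omega>. V \<omega>' \<le> V \<omega>}}"
    and W: "W \<subseteq> \<Omega>" "\<And>\<omega> \<omega>'. \<omega> \<in> \<Omega> - W \<Longrightarrow> \<omega>' \<in> W \<Longrightarrow> V \<omega> < V \<omega>'"
    and M: "M \<subseteq> \<Omega>" "sum w M = \<eta>" "0 < \<eta>"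
    and \<delta>: "sum w ((W - M) \<union> (M - W)) \<le> \<delta>"
  shows "min 1 (\<eta> / \<theta>) - a / \<eta> - \<delta> / \<theta> \<le> sum w (M \<inter> B) / sum w B"
proof -
  define P where "P = sum w B"
  have bounds: "\<theta> \<le> P" "P \<le> \<theta> + a"
    using quantile_event_bounds[OF fin w \<theta> atom B] by (simp_all add: P_def)
  have BO: "B \<subseteq> \<Omega>" using B by auto
  have mono: "sum w S \<le> sum w T" if "S \<subseteq> T" "T \<subseteq> \<Omega>" for S T
    using that w fin by (intro sum_mono2) (auto intro: finite_subset)
  have fs: "finite M" "finite B" "finite W" using fin M W BO by (auto intro: finite_subset)
  have "{} \<subseteq> {\<omega>\<in>\<Omega>. V \<omega> = 0}" by simp
  then have "sum w {} \<le> sum w {\<omega>\<in>\<Omega>. V \<omega> = 0}" by (rule mono) auto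
  with atom[of 0] have a: "0 \<le> a" by simp
  have "sum w {} \<le> sum w ((W - M) \<union> (M - W))" using M W by (intro mono) auto
  with \<delta> have \<delta>0: "0 \<le> \<delta>" by simp
  have \<delta>P: "\<delta> / P \<le> \<delta> / \<theta>" using bounds \<theta> \<delta>0 by (intro divide_left_mono) auto
  have first: ?thesis if "P - \<delta> \<le> sum w (M \<inter> B)"
  proof -
    have "1 - \<delta> / P = (P - \<delta>) / P" using bounds \<theta> by (simp add: field_simps)
    also have "\<dots> \<le> sum w (M \<inter> B) / P" using bounds \<theta> that by (intro divide_right_mono) auto
    finally show ?thesis
      using \<delta>P divide_nonneg_pos[OF a M(3)] min.cobounded1[of 1 "\<eta> / \<theta>"]
      unfolding P_def by linarith
  qed
  \<comment> \<open>\<open>B\<close> is closed upwards in \<open>V\<close>, and all values on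
    \<open>W\<close> exceed all values off \<open>W\<close>, so the two sets are nested.\<close>
  have dich: "B \<subseteq> W \<or> W \<subseteq> B"
  proof (rule disjCI)
    assume "\<not> W \<subseteq> B"
    then obtain \<omega>' where \<omega>': "\<omega>' \<in> W" "\<omega>' \<notin> B" by auto
    show "B \<subseteq> W"
    proof (rule ccontr)
      assume "\<not> B \<subseteq> W"
      then obtain \<omega> where \<omega>: "\<omega> \<in> B" "\<omega> \<notin> W" by auto
      then have "V \<omega> < V \<omega>'" using W(2)[of \<omega> \<omega>'] \<omega>' BO by auto
      then have "sum w {\<omega>''\<in>\<Omega>. V \<omega>'' \<le> V \<omega>} \<le> sum w {\<omega>''\<in>\<Omega>. V \<omega>'' \<le> V \<omega>'}"
        by (intro mono) auto
      then show False using \<omega> \<omega>' B W by auto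
    qed
  qed
  then show ?thesis
  proof
    assume "B \<subseteq> W"
    then have "B - M \<subseteq> (W - M) \<union> (M - W)" by auto
    then have "sum w (B - M) \<le> sum w ((W - M) \<union> (M - W))"
      by (rule mono) (use M W in auto)
    also note \<delta>
    finally have "sum w (B - M) \<le> \<delta>" .
    moreover have "sum w B = sum w (B \<inter> M) + sum w (B - M)"
      by (rule sum.Int_Diff) (rule fs)
    ultimately show ?thesis using first by (simp add: P_def Int_commute)
  next
    assume "W \<subseteq> B"
    then have "M - B \<subseteq> (W - M) \<union> (M - W)" by auto
    then have "sum w (M - B) \<le> sum w ((W - M) \<union> (M - W))"
      by (rule mono) (use M W in auto)
    also note \<delta>
    finally have "sum w (M - B) \<le> \<delta>" .
    moreover have "sum w M = sum w (M \<inter> B) + sum w (M - B)"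
      by (rule sum.Int_Diff) (rule fs)
    ultimately have MB: "\<eta> - \<delta> \<le> sum w (M \<inter> B)" using M by simp
    show ?thesis
    proof (cases "P \<le> \<eta>")
      case True
      then show ?thesis using first MB by simp
    next
      case False
      \<comment> \<open>With this choice \<open>min 1 (\<eta> / \<theta>)\<close> is
        \<open>\<eta> / m\<close>, and \<open>P\<close> exceeds \<open>m\<close> by at most
        \<open>a\<close>. As \<open>P\<close> is larger than \<eta>, the relative excess is at most
        \<open>a / \<eta>\<close>.\<close>
      define m where "m = max \<theta> \<eta>"
      have m: "\<theta> \<le> m" "\<eta> \<le> m" "m \<le> P" "0 < m" "P - m \<le> a"
        using False bounds M \<theta> by (auto simp: m_def)
      have "min 1 (\<eta> / \<theta>) - \<eta> / P = \<eta> / m - \<eta> / P"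
        using \<theta> M by (simp add: m_def min_def max_def field_simps)
      also have "\<dots> = (\<eta> / m) * ((P - m) / P)" using m by (simp add: field_simps)
      also have "\<dots> \<le> 1 * (a / \<eta>)"
      proof (intro mult_mono)
        show "(P - m) / P \<le> a / \<eta>" using m M a by (intro frac_le) auto
      qed (use m M a in auto)
      finally have 1: "min 1 (\<eta> / \<theta>) - a / \<eta> \<le> \<eta> / P" by simp
      have "\<eta> / P - \<delta> / P \<le> sum w (M \<inter> B) / P"
        using MB bounds \<theta> by (simp add: divide_right_mono flip: diff_divide_distrib)
      then show ?thesis using 1 \<delta>P by (simp add: P_def)
    qed
  qed
qed

section \<open>Expectations under the toy distribution\<close>

definition texp :: "nat \<Rightarrow> real \<Rightarrow> (nat \<Rightarrow> real) \<Rightarrow> (nat \<Rightarrow> real) \<Rightarrow>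
    ((nat \<Rightarrow> real) \<times> real \<times> real \<Rightarrow> real) \<Rightarrow> real" where
  "texp n \<eta> p p' f = (\<Sum>\<omega>\<in>outcomes n. toy_pmf n \<eta> p p' \<omega> * f \<omega>)"

lemma finite_outcomes [simp]: "finite (outcomes n)"
  by (simp add: outcomes_def)

text \<open>Conditioning on the four values of the pair \<open>(y, z)\<close>: the class
  \<open>z\<close> selects \<open>p\<close> or \<open>p'\<close>, and agreement of \<open>y\<close>
  with \<open>z\<close> selects the weight.\<close>

lemma texp_bexp:
  "texp n \<eta> p p' f =
    ((1 - \<eta>) * bexp n p (\<lambda>x. f (x, 1, 1)) + \<eta> * bexp n p (\<lambda>x. f (x, -1, 1))
      + \<eta> * bexp n p' (\<lambda>x. f (x, 1, -1)) + (1 - \<eta>) * bexp n p' (\<lambda>x. f (x, -1, -1))) / 2"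
proof -
  have "texp n \<eta> p p' f = (\<Sum>x\<in>cube n. \<Sum>y\<in>{-1, 1}. \<Sum>z\<in>{-1, 1}.
      toy_pmf n \<eta> p p' (x, y, z) * f (x, y, z))"
    unfolding texp_def outcomes_def sum.cartesian_product by (simp only: case_prod_unfold prod.collapse)
  moreover have
    "toy_pmf n \<eta> p p' (x, 1, 1) * r =
      (1 - \<eta>) / 2 * ((\<Prod>i<n. if x i = 1 then p i else 1 - p i) * r)"
    "toy_pmf n \<eta> p p' (x, -1, 1) * r =
      \<eta> / 2 * ((\<Prod>i<n. if x i = 1 then p i else 1 - p i) * r)"
    "toy_pmf n \<eta> p p' (x, 1, -1) * r =
      \<eta> / 2 * ((\<Prod>i<n. if x i = 1 then p' i else 1 - p' i) * r)"
    "toy_pmf n \<eta> p p' (x, -1, -1) * r =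
      (1 - \<eta>) / 2 * ((\<Prod>i<n. if x i = 1 then p' i else 1 - p' i) * r)" for x r
    by (simp_all add: toy_pmf_def Let_def cong: if_cong)
  ultimately have "texp n \<eta> p p' f =
      (1 - \<eta>) / 2 * bexp n p (\<lambda>x. f (x, 1, 1)) + \<eta> / 2 * bexp n p (\<lambda>x. f (x, -1, 1))
      + \<eta> / 2 * bexp n p' (\<lambda>x. f (x, 1, -1)) + (1 - \<eta>) / 2 * bexp n p' (\<lambda>x. f (x, -1, -1))"
    by (simp add: bexp_def sum.distrib sum_distrib_left sum_divide_distrib)
  then show ?thesis by (simp add: field_simps)
qed

lemma texp_add: "texp n \<eta> p p' (\<lambda>\<omega>. f \<omega> + g \<omega>) = texp n \<eta> p p' f + texp n \<eta> p p' g"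
  by (simp add: texp_def distrib_left sum.distrib)

lemma texp_cmult: "texp n \<eta> p p' (\<lambda>\<omega>. c * f \<omega>) = c * texp n \<eta> p p' f"
  by (simp add: texp_def sum_distrib_left mult_ac)

lemma texp_const [simp]: "texp n \<eta> p p' (\<lambda>\<omega>. c) = c"
  by (simp add: texp_bexp algebra_simps)

lemma sum_toy_pmf: "(\<Sum>\<omega>\<in>{\<omega>\<in>outcomes n. E \<omega>}. toy_pmf n \<eta> p p' \<omega>) =
    texp n \<eta> p p' (\<lambda>\<omega>. of_bool (E \<omega>))"
  by (simp add: texp_def sum.inter_filter of_bool_def if_distrib cong: if_cong)

lemma toy_pmf_nonneg:
  assumes "\<And>i. i < n \<Longrightarrow> 0 \<le> p i \<and> p i \<le> 1 \<and> 0 \<le> p' i \<and> p' i \<le> 1" "0 \<le> \<eta>" "\<eta> \<le> 1"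
  shows "0 \<le> toy_pmf n \<eta> p p' \<omega>"
  unfolding toy_pmf_def Let_def using assms
  by (auto split: prod.split intro!: mult_nonneg_nonneg prod_nonneg)

lemma texp_mono:
  assumes "\<And>i. i < n \<Longrightarrow> 0 \<le> p i \<and> p i \<le> 1 \<and> 0 \<le> p' i \<and> p' i \<le> 1" "0 \<le> \<eta>" "\<eta> \<le> 1"
    and "\<And>\<omega>. \<omega> \<in> outcomes n \<Longrightarrow> f \<omega> \<le> g \<omega>"
  shows "texp n \<eta> p p' f \<le> texp n \<eta> p p' g"
  unfolding texp_def by (intro sum_mono mult_left_mono assms(4) toy_pmf_nonneg assms(1-3))

section \<open>Normal equations and separation of the two classes\<close>

text \<open>At \<open>t = - a\<close> the quadratic equals \<open>- a\<^sup>2\<close>.\<close>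

lemma linear_term_zero:
  fixes a :: real
  assumes "\<And>t. 0 \<le> 2 * t * a + t\<^sup>2"
  shows "a = 0"
  using assms[of "- a"] by (auto simp: power2_eq_square mult_le_0_iff)

text \<open>Since \<open>X\<^sub>i\<^sup>2 = 1\<close>, shifting any one coefficient by \<open>t\<close> changes
  the risk by a linear term plus exactly \<open>t\<^sup>2\<close>.\<close>
lemma normal_equation:
  assumes min: "risk_minimizer n \<eta> p p' b0 b"
    and g: "\<And>x. x \<in> cube n \<Longrightarrow> (g x)\<^sup>2 = 1"
    and shift: "\<And>t. \<exists>c0 c. \<forall>x\<in>cube n. lin_pred n c0 c x = lin_pred n b0 b x + t * g x"
  shows "texp n \<eta> p p' (\<lambda>(x, y, z). (lin_pred n b0 b x - y) * g x) = 0"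
proof (rule linear_term_zero)
  fix t
  obtain c0 c where c: "\<And>x. x \<in> cube n \<Longrightarrow> lin_pred n c0 c x = lin_pred n b0 b x + t * g x"
    using shift by blast
  let ?R = "\<lambda>\<omega>. (case \<omega> of (x, y, z) \<Rightarrow> (lin_pred n b0 b x - y)\<^sup>2)"
  let ?G = "\<lambda>\<omega>. (case \<omega> of (x, y, z) \<Rightarrow> (lin_pred n b0 b x - y) * g x)"
  have "toy_risk n \<eta> p p' c0 c = texp n \<eta> p p' (\<lambda>\<omega>. (?R \<omega> + (2 * t) * ?G \<omega>) + t\<^sup>2)"
    unfolding toy_risk_def texp_def
  proof (intro sum.cong refl arg_cong2[where f = "(*)"])
    fix \<omega> assume \<omega>: "\<omega> \<in> outcomes n"
    obtain x y z where [simp]: "\<omega> = (x, y, z)" by (cases \<omega>) auto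
    have x: "x \<in> cube n" using \<omega> by (simp add: outcomes_def)
    have "(lin_pred n c0 c x - y)\<^sup>2 =
        (lin_pred n b0 b x - y)\<^sup>2 + 2 * t * ((lin_pred n b0 b x - y) * g x) + t\<^sup>2 * (g x)\<^sup>2"
      by (simp add: c[OF x] power2_eq_square algebra_simps)
    then show "(case \<omega> of (x, y, z) \<Rightarrow> (lin_pred n c0 c x - y)\<^sup>2) = (?R \<omega> + (2 * t) * ?G \<omega>) + t\<^sup>2"
      by (simp add: g[OF x])
  qed
  also have "\<dots> = toy_risk n \<eta> p p' b0 b + 2 * t * texp n \<eta> p p' ?G + t\<^sup>2"
    by (simp only: texp_add texp_cmult texp_const) (simp add: toy_risk_def texp_def)
  finally show "0 \<le> 2 * t * texp n \<eta> p p' ?G + t\<^sup>2"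
    using min unfolding risk_minimizer_def by (smt (verit))
qed

text \<open>The label has mean 0, so the intercept equation makes the class means of the predictor
  opposite. In the equation for \<open>x i\<close>, the label contributes
  \<open>(1 - 2 * \<eta>) * (p i - p' i)\<close>, while the predictor contributes
  \<open>e * (p i - p' i)\<close> through the class means and \<open>b i * D i\<close> through the
  conditional variances.\<close>

lemma risk_minimizer_coefficients:
  fixes p p' :: "nat \<Rightarrow> real"
  assumes min: "risk_minimizer n \<eta> p p' b0 b"
    and D: "\<And>i. D i = ((1 - (2 * p i - 1)\<^sup>2) + (1 - (2 * p' i - 1)\<^sup>2)) / 2"
    and e: "e = bexp n p (lin_pred n b0 b)"
  shows "bexp n p' (lin_pred n b0 b) = - e"
    and "e = (\<Sum>i<n. b i * (p i - p' i))"
    and "\<And>i. i < n \<Longrightarrow> b i * D i = ((1 - 2 * \<eta>) - e) * (p i - p' i)"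
proof -
  have "texp n \<eta> p p' (\<lambda>(x, y, z). (lin_pred n b0 b x - y) * 1) = 0"
  proof (rule normal_equation[OF min])
    fix t
    show "\<exists>c0 c. \<forall>x\<in>cube n. lin_pred n c0 c x = lin_pred n b0 b x + t * 1"
      by (rule exI[of _ "b0 + t"], rule exI[of _ b]) (simp add: lin_pred_def)
  qed simp
  then show e': "bexp n p' (lin_pred n b0 b) = - e"
    by (simp add: texp_bexp bexp_diff bexp_add e) (simp add: algebra_simps)
  have "bexp n p (lin_pred n b0 b) - bexp n p' (lin_pred n b0 b) = 2 * (\<Sum>i<n. b i * (p i - p' i))"
    unfolding bexp_lin_pred
    by (simp add: sum_distrib_left algebra_simps flip: sum_subtractf)
  then show "e = (\<Sum>i<n. b i * (p i - p' i))" using e e' by simp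
  fix i assume i: "i < n"
  have "texp n \<eta> p p' (\<lambda>(x, y, z). (lin_pred n b0 b x - y) * x i) = 0"
  proof (rule normal_equation[OF min])
    fix x assume "x \<in> cube n"
    then have "x i \<in> {-1, 1}" using i by (auto simp: cube_def)
    then show "(x i)\<^sup>2 = 1" by auto
  next
    fix t
    have "lin_pred n b0 (b(i := b i + t)) x = lin_pred n b0 b x + t * x i" for x
    proof -
      have "(\<Sum>j<n. (b(i := b i + t)) j * x j) = (\<Sum>j<n. b j * x j + (if j = i then t * x j else 0))"
        by (intro sum.cong) (auto simp: algebra_simps)
      then show ?thesis using i by (simp add: lin_pred_def sum.distrib)
    qed
    then show "\<exists>c0 c. \<forall>x\<in>cube n. lin_pred n c0 c x = lin_pred n b0 b x + t * x i"
      by blast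
  qed
  moreover have "bexp n q (\<lambda>x. (lin_pred n b0 b x - s) * x i) =
      bexp n q (lin_pred n b0 b) * (2 * q i - 1) + b i * (1 - (2 * q i - 1)\<^sup>2) - s * (2 * q i - 1)"
    for s q
    using i by (simp add: left_diff_distrib bexp_diff bexp_cmult bexp_coord bexp_lin_pred_coord)
  from calculation this[of _ 1] this[of _ "-1"]
  have "(1 - \<eta>) * (e * (2 * p i - 1) + b i * (1 - (2 * p i - 1)\<^sup>2) - (2 * p i - 1))
      + \<eta> * (e * (2 * p i - 1) + b i * (1 - (2 * p i - 1)\<^sup>2) + (2 * p i - 1))
      + \<eta> * (- e * (2 * p' i - 1) + b i * (1 - (2 * p' i - 1)\<^sup>2) - (2 * p' i - 1))
      + (1 - \<eta>) * (- e * (2 * p' i - 1) + b i * (1 - (2 * p' i - 1)\<^sup>2) + (2 * p' i - 1)) = 0"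
    unfolding texp_bexp by (simp add: e' flip: e) (simp add: algebra_simps)
  then show "b i * D i = ((1 - 2 * \<eta>) - e) * (p i - p' i)"
    unfolding D by (simp add: field_simps)
qed

lemma risk_minimizer_separates:
  fixes p p' :: "nat \<Rightarrow> real"
  assumes \<epsilon>: "0 < \<epsilon>" and \<eta>: "\<eta> < 1 / 2" and n: "0 < n"
    and p: "\<And>i. i < n \<Longrightarrow> \<epsilon> \<le> p i \<and> p i \<le> 1 - \<epsilon> \<and> \<epsilon> \<le> p' i \<and> p' i \<le> 1 - \<epsilon> \<and> \<epsilon> \<le> \<bar>p i - p' i\<bar>"
    and min: "risk_minimizer n \<eta> p p' b0 b"
  shows "\<And>i. i < n \<Longrightarrow> b i \<noteq> 0"
    and "texp n \<eta> p p' (\<lambda>(x, y, z). of_bool (lin_pred n b0 b x * z \<le> 0)) \<le> 2 / \<epsilon>\<^sup>2 / real n"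
proof -
  define D where "D = (\<lambda>i. ((1 - (2 * p i - 1)\<^sup>2) + (1 - (2 * p' i - 1)\<^sup>2)) / 2)"
  define e where "e = bexp n p (lin_pred n b0 b)"
  define r where "r = 1 - 2 * \<eta> - e"
  define S where "S = (\<Sum>i<n. (p i - p' i)\<^sup>2 / D i)"
  have "D i = ((1 - (2 * p i - 1)\<^sup>2) + (1 - (2 * p' i - 1)\<^sup>2)) / 2" for i
    by (simp add: D_def)
  note coeffs = risk_minimizer_coefficients[OF min this e_def]
  have pos: "0 < 1 - (2 * q - 1)\<^sup>2" "1 - (2 * q - 1)\<^sup>2 \<le> 1" if "\<epsilon> \<le> q" "q \<le> 1 - \<epsilon>" for q
  proof -
    have "1 - (2 * q - 1)\<^sup>2 = 4 * (q * (1 - q))" by (simp add: power2_eq_square algebra_simps)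
    moreover have "0 < q * (1 - q)" using that \<epsilon> by (intro mult_pos_pos) auto
    ultimately show "0 < 1 - (2 * q - 1)\<^sup>2" by simp
  qed simp
  have D: "0 < D i" "D i \<le> 1" "1 - (2 * p i - 1)\<^sup>2 \<le> 2 * D i" "1 - (2 * p' i - 1)\<^sup>2 \<le> 2 * D i"
    if "i < n" for i
    using pos[of "p i"] pos[of "p' i"] p[OF that] by (auto simp: D_def)
  have b: "b i = r * (p i - p' i) / D i" if "i < n" for i
    using coeffs(3)[OF that] D[OF that] by (simp add: r_def nonzero_eq_divide_eq)
  have eS: "e = r * S"
    unfolding coeffs(2) S_def sum_distrib_left
    by (intro sum.cong) (auto simp: b power2_eq_square)
  have "real n * \<epsilon>\<^sup>2 = (\<Sum>i<n. \<epsilon>\<^sup>2)" by simp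
  also have "\<dots> \<le> S" unfolding S_def
  proof (intro sum_mono)
    fix i assume "i \<in> {..<n}"
    then have i: "i < n" by simp
    have "\<epsilon>\<^sup>2 \<le> \<bar>p i - p' i\<bar>\<^sup>2" using p[OF i] \<epsilon> by (intro power_mono) auto
    also have "\<dots> \<le> (p i - p' i)\<^sup>2 / D i" using D[OF i] by (simp add: pos_le_divide_eq mult_left_le)
    finally show "\<epsilon>\<^sup>2 \<le> (p i - p' i)\<^sup>2 / D i" .
  qed
  finally have S: "real n * \<epsilon>\<^sup>2 \<le> S" .
  moreover have "0 < real n * \<epsilon>\<^sup>2" using \<epsilon> n by simp
  ultimately have S0: "0 < S" by linarith
  \<comment> \<open>Inserting \<open>e = r * S\<close> into the definition of \<open>r\<close>
    solves for \<open>r\<close>; its positivity is where \<open>\<eta> < 1 / 2\<close>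
    enters.\<close>
  have "r * (1 + S) = 1 - 2 * \<eta>" using eS by (simp add: r_def algebra_simps)
  then have r: "0 < r" using S0 \<eta> zero_less_mult_pos2[of r "1 + S"] by simp
  then have e0: "0 < e" using eS S0 by simp
  show "b i \<noteq> 0" if "i < n" for i
    using b[OF that] r D[OF that] p[OF that] \<epsilon> by auto
  \<comment> \<open>Each conditional variance is at most twice the average \<open>D i\<close>, so
    the coefficient equations bound the variance of the predictor by \<open>2 * r * e\<close>.
    Dividing by the squared mean leaves \<open>2 / S\<close>, and \<open>S\<close> grows linearly in
    \<open>n\<close>.\<close>
  have var: "(\<Sum>i<n. (b i)\<^sup>2 * (1 - (2 * q i - 1)\<^sup>2)) / e\<^sup>2 \<le> 2 / \<epsilon>\<^sup>2 / real n"
    if q: "\<And>i. i < n \<Longrightarrow> 1 - (2 * q i - 1)\<^sup>2 \<le> 2 * D i" for q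
  proof -
    have "(\<Sum>i<n. (b i)\<^sup>2 * (1 - (2 * q i - 1)\<^sup>2)) \<le> (\<Sum>i<n. (b i)\<^sup>2 * (2 * D i))"
      by (intro sum_mono mult_left_mono q) auto
    also have "\<dots> = (\<Sum>i<n. 2 * r * (b i * (p i - p' i)))"
    proof (intro sum.cong refl)
      fix i assume "i \<in> {..<n}"
      then have "b i * D i = r * (p i - p' i)" using coeffs(3) by (simp add: r_def)
      then show "(b i)\<^sup>2 * (2 * D i) = 2 * r * (b i * (p i - p' i))"
        by (simp add: power2_eq_square)
    qed
    also have "\<dots> = 2 * r * e" by (simp add: coeffs(2) sum_distrib_left)
    finally have "(\<Sum>i<n. (b i)\<^sup>2 * (1 - (2 * q i - 1)\<^sup>2)) / e\<^sup>2 \<le> 2 * r * e / e\<^sup>2"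
      by (rule divide_right_mono) simp
    also have "\<dots> = 2 / S" using r S0 by (simp add: eS power2_eq_square)
    also have "\<dots> \<le> 2 / (real n * \<epsilon>\<^sup>2)" using S S0 \<epsilon> n by (intro divide_left_mono) auto
    finally show ?thesis by (simp add: mult.commute)
  qed
  have 1: "bexp n p (\<lambda>x. of_bool (lin_pred n b0 b x * 1 \<le> 0)) \<le> 2 / \<epsilon>\<^sup>2 / real n"
    by (rule order_trans[OF chebyshev_sign[where e = e] var])
      (use p \<epsilon> e0 D in \<open>force simp: e_def\<close>)+
  have 2: "bexp n p' (\<lambda>x. of_bool (lin_pred n b0 b x * (-1) \<le> 0)) \<le> 2 / \<epsilon>\<^sup>2 / real n"
    by (rule order_trans[OF chebyshev_sign[where e = e] var])
      (use p \<epsilon> e0 D coeffs(1) in force)+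
  \<comment> \<open>The event ignores \<open>y\<close>, so the weights \<eta> and
    \<open>1 - \<eta>\<close> recombine within each class.\<close>
  have halves: "texp n \<eta> p p' (\<lambda>(x, y, z). of_bool (lin_pred n b0 b x * z \<le> 0)) =
      (bexp n p (\<lambda>x. of_bool (lin_pred n b0 b x * 1 \<le> 0))
        + bexp n p' (\<lambda>x. of_bool (lin_pred n b0 b x * (-1) \<le> 0))) / 2"
    unfolding texp_bexp prod.case by (simp add: algebra_simps)
  show "texp n \<eta> p p' (\<lambda>(x, y, z). of_bool (lin_pred n b0 b x * z \<le> 0)) \<le> 2 / \<epsilon>\<^sup>2 / real n"
  proof -
    have "(u + v) / 2 \<le> c" if "u \<le> c" "v \<le> c" for u v c :: real using that by simp
    from this[OF 1 2] show ?thesis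
      unfolding halves .
  qed
qed

section \<open>Atoms of the error and the conditional probability bound\<close>

text \<open>For a fixed label, injectivity of \<open>Err\<close> in the prediction makes each error
  level at most one value of the predictor, so anticoncentration passes to the error.\<close>

lemma error_atom_bound:
  fixes p p' :: "nat \<Rightarrow> real"
  assumes \<epsilon>: "0 < \<epsilon>" "\<epsilon> < 1 / 2" and \<eta>: "0 \<le> \<eta>" "\<eta> < 1 / 2" and n: "0 < n"
    and p: "\<And>i. i < n \<Longrightarrow> \<epsilon> \<le> p i \<and> p i \<le> 1 - \<epsilon> \<and> \<epsilon> \<le> p' i \<and> p' i \<le> 1 - \<epsilon>"
    and b: "\<And>i. i < n \<Longrightarrow> b i \<noteq> 0"
    and good: "good_error_function Err"
  shows "texp n \<eta> p p' (\<lambda>(x, y, z). of_bool (Err (lin_pred n b0 b x) y = v)) \<le>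
    2 / sqrt (\<epsilon> / 2) / sqrt (real n)" (is "_ \<le> ?A")
proof -
  \<comment> \<open>\<open>a y\<close> is arbitrary when \<open>v\<close> is not a value of the error; the bound then holds trivially.\<close>
  define a where "a = (\<lambda>y. SOME u. Err u y = v)"
  have a: "u = a y" if "Err u y = v" "y \<in> {-1, 1}" for u y
  proof -
    have "Err (a y) y = v" unfolding a_def using that(1) by (rule someI)
    then show ?thesis using good that unfolding good_error_function_def by metis
  qed
  have "texp n \<eta> p p' (\<lambda>(x, y, z). of_bool (Err (lin_pred n b0 b x) y = v)) \<le>
      texp n \<eta> p p' (\<lambda>(x, y, z). of_bool (lin_pred n b0 b x = a y))"
  proof (intro texp_mono)
    show "0 \<le> p i \<and> p i \<le> 1 \<and> 0 \<le> p' i \<and> p' i \<le> 1" if "i < n" for i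
      using p[OF that] \<epsilon> by auto
  qed (use \<eta> a in \<open>auto simp: outcomes_def\<close>)
  also have "\<dots> \<le> ((1 - \<eta>) * ?A + \<eta> * ?A + \<eta> * ?A + (1 - \<eta>) * ?A) / 2"
    unfolding texp_bexp prod.case using \<epsilon> \<eta> p b n
    by (intro divide_right_mono add_mono mult_left_mono littlewood_offord_point) auto
  also have "\<dots> = ?A"
  proof -
    have "((1 - \<eta>) * r + \<eta> * r + \<eta> * r + (1 - \<eta>) * r) / 2 = r" for r
      by (simp add: algebra_simps)
    then show ?thesis .
  qed
  finally show ?thesis .
qed

text \<open>The quantile estimate with the Littlewood-Offord bound as atom size and the Chebyshev
  bound as the mass where label noise and wrong prediction disagree.\<close>

lemma toy_cond_prob_lower_bound:
  fixes p p' :: "nat \<Rightarrow> real"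
  assumes \<epsilon>: "0 < \<epsilon>" "\<epsilon> < 1 / 2" and \<eta>: "0 < \<eta>" "\<eta> < 1 / 2" and n: "0 < n"
    and p: "\<And>i. i < n \<Longrightarrow> \<epsilon> \<le> p i \<and> p i \<le> 1 - \<epsilon> \<and> \<epsilon> \<le> p' i \<and> p' i \<le> 1 - \<epsilon> \<and> \<epsilon> \<le> \<bar>p i - p' i\<bar>"
    and min: "risk_minimizer n \<eta> p p' b0 b"
    and good: "good_error_function Err" and \<theta>: "0 < \<theta>" "\<theta> \<le> 1"
    and V: "V = (\<lambda>(x, y, z). Err (lin_pred n b0 b x) y)"
  shows "min 1 (\<eta> / \<theta>) - 2 / sqrt (\<epsilon> / 2) / sqrt (real n) / \<eta> - 2 / \<epsilon>\<^sup>2 / real n / \<theta> \<le>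
    toy_cond_prob n \<eta> p p' (\<lambda>(x, y, z). y * z = -1)
      (\<lambda>\<omega>. toy_cdf n \<eta> p p' V (V \<omega>) \<ge> 1 - \<theta>)"
proof -
  have p01: "0 \<le> p i \<and> p i \<le> 1 \<and> 0 \<le> p' i \<and> p' i \<le> 1" if "i < n" for i
    using p[OF that] \<epsilon> by auto
  have \<eta>01: "0 \<le> \<eta>" "\<eta> \<le> 1" using \<eta> by auto
  note separates = risk_minimizer_separates[OF \<epsilon>(1) \<eta>(2) n p min]
  define w where "w = toy_pmf n \<eta> p p'"
  define M where "M = {\<omega>\<in>outcomes n. case \<omega> of (x, y, z) \<Rightarrow> y * z = -1}"
  define W where "W = {\<omega>\<in>outcomes n. case \<omega> of (x, y, z) \<Rightarrow> lin_pred n b0 b x * y \<le> 0}"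
  define B where "B = {\<omega>\<in>outcomes n. 1 - \<theta> \<le> sum w {\<omega>'\<in>outcomes n. V \<omega>' \<le> V \<omega>}}"
  have "min 1 (\<eta> / \<theta>) - 2 / sqrt (\<epsilon> / 2) / sqrt (real n) / \<eta> - 2 / \<epsilon>\<^sup>2 / real n / \<theta> \<le>
      sum w (M \<inter> B) / sum w B"
  proof (rule quantile_event_ratio[where \<Omega> = "outcomes n" and V = V and W = W])
    show "0 \<le> w \<omega>" for \<omega> unfolding w_def by (rule toy_pmf_nonneg[OF p01 \<eta>01])
    show "sum w (outcomes n) = 1"
      using texp_const[of n \<eta> p p' 1, unfolded texp_def] by (simp add: w_def)
    show "sum w {\<omega>\<in>outcomes n. V \<omega> = v} \<le> 2 / sqrt (\<epsilon> / 2) / sqrt (real n)" for v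
    proof -
      have "texp n \<eta> p p' (\<lambda>(x, y, z). of_bool (Err (lin_pred n b0 b x) y = v)) \<le>
          2 / sqrt (\<epsilon> / 2) / sqrt (real n)"
        by (rule error_atom_bound[OF \<epsilon> \<eta>01(1) \<eta>(2) n _ separates(1) good]) (use p in auto)
      then show ?thesis unfolding w_def sum_toy_pmf V by (simp only: case_prod_unfold)
    qed
    show "V \<omega> < V \<omega>'" if "\<omega> \<in> outcomes n - W" "\<omega>' \<in> W" for \<omega> \<omega>'
    proof -
      obtain x y z x' y' z' where \<omega>: "\<omega> = (x, y, z)" "\<omega>' = (x', y', z')"
        by (cases \<omega>, cases \<omega>') auto
      have "y \<in> {-1, 1}" "y' \<in> {-1, 1}" "lin_pred n b0 b x * y > 0" "lin_pred n b0 b x' * y' \<le> 0"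
        using that by (auto simp: \<omega> W_def outcomes_def)
      then show ?thesis using good by (simp only: \<omega> V good_error_function_def prod.case)
    qed
    show "sum w M = \<eta>"
      unfolding w_def M_def sum_toy_pmf by (simp add: texp_bexp)
    have "sum w ((W - M) \<union> (M - W)) \<le>
        sum w {\<omega>\<in>outcomes n. case \<omega> of (x, y, z) \<Rightarrow> lin_pred n b0 b x * z \<le> 0}"
    proof (intro sum_mono2)
      \<comment> \<open>If the predictor has strictly the sign of \<open>z\<close>, then it
        disagrees with \<open>y\<close> exactly when \<open>y\<close> was flipped.\<close>
      show "(W - M) \<union> (M - W) \<subseteq>
          {\<omega>\<in>outcomes n. case \<omega> of (x, y, z) \<Rightarrow> lin_pred n b0 b x * z \<le> 0}"
        unfolding W_def M_def outcomes_def by auto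
    qed (simp_all add: w_def toy_pmf_nonneg[OF p01 \<eta>01])
    also have "\<dots> \<le> 2 / \<epsilon>\<^sup>2 / real n"
      unfolding w_def sum_toy_pmf using separates(2) by (simp only: case_prod_unfold)
    finally show "sum w ((W - M) \<union> (M - W)) \<le> 2 / \<epsilon>\<^sup>2 / real n" .
    show "B = {\<omega>\<in>outcomes n. 1 - \<theta> \<le> sum w {\<omega>'\<in>outcomes n. V \<omega>' \<le> V \<omega>}}" by (rule B_def)
  qed (use \<theta> \<eta> in \<open>auto simp: M_def W_def\<close>)
  moreover have "M \<inter> B = {\<omega>\<in>outcomes n. (case \<omega> of (x, y, z) \<Rightarrow> y * z = -1) \<and>
      toy_cdf n \<eta> p p' V (V \<omega>) \<ge> 1 - \<theta>}"
    "B = {\<omega>\<in>outcomes n. toy_cdf n \<eta> p p' V (V \<omega>) \<ge> 1 - \<theta>}"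
    by (auto simp: M_def B_def w_def toy_cdf_def toy_prob_def)
  ultimately show ?thesis
    by (simp add: toy_cond_prob_def toy_prob_def w_def)
qed

lemma toy_cond_prob_nonneg:
  assumes "\<And>i. i < n \<Longrightarrow> 0 \<le> p i \<and> p i \<le> 1 \<and> 0 \<le> p' i \<and> p' i \<le> 1" "0 \<le> \<eta>" "\<eta> \<le> 1"
  shows "0 \<le> toy_cond_prob n \<eta> p p' A B"
  unfolding toy_cond_prob_def toy_prob_def
  by (intro divide_nonneg_nonneg sum_nonneg toy_pmf_nonneg assms)

theorem mainTheorem7:
  fixes Err :: "real \<Rightarrow> real \<Rightarrow> real" and \<epsilon> \<eta> :: real
  assumes "good_error_function Err"
    and "0 < \<epsilon>" and "\<epsilon> < 1/2" and "0 \<le> \<eta>" and "\<eta> < 1/2"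
  shows "\<exists>C>0. \<forall>\<theta>. 0 < \<theta> \<and> \<theta> \<le> 1 \<longrightarrow> (\<exists>N::nat. \<forall>n\<ge>N.
     \<forall>p p' :: nat \<Rightarrow> real. \<forall>b0 :: real. \<forall>b :: nat \<Rightarrow> real.
       (\<forall>i<n. \<epsilon> \<le> p i \<and> p i \<le> 1 - \<epsilon> \<and> \<epsilon> \<le> p' i \<and> p' i \<le> 1 - \<epsilon> \<and> \<bar>p i - p' i\<bar> \<ge> \<epsilon>) \<longrightarrow>
       risk_minimizer n \<eta> p p' b0 b \<longrightarrow>
       (let V = (\<lambda>(x, y, z). Err (lin_pred n b0 b x) y) in
        toy_cond_prob n \<eta> p p'
          (\<lambda>(x, y, z). y * z = -1)
          (\<lambda>\<omega>. toy_cdf n \<eta> p p' V (V \<omega>) \<ge> 1 - \<theta>)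
        \<ge> min 1 (\<eta> / \<theta>) - C / sqrt (real n)))"
proof (cases "\<eta> = 0")
  case True
  \<comment> \<open>Without label noise the claimed lower bound is at most 0, so nonnegativity of
    the quotient suffices, with constant 1.\<close>
  have "min 1 (\<eta> / \<theta>) - 1 / sqrt (real n) \<le> toy_cond_prob n \<eta> p p' A B"
    if "\<forall>i<n. \<epsilon> \<le> p i \<and> p i \<le> 1 - \<epsilon> \<and> \<epsilon> \<le> p' i \<and> p' i \<le> 1 - \<epsilon> \<and> \<bar>p i - p' i\<bar> \<ge> \<epsilon>"
    for \<theta> n p p' A B
  proof -
    have "0 \<le> toy_cond_prob n \<eta> p p' A B"
    proof (rule toy_cond_prob_nonneg)
      show "0 \<le> p i \<and> p i \<le> 1 \<and> 0 \<le> p' i \<and> p' i \<le> 1" if "i < n" for i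
        using that \<open>\<forall>i<n. _ i\<close> assms(2) by (smt (verit))
    qed (use True in auto)
    moreover have "min 1 (\<eta> / \<theta>) - 1 / sqrt (real n) \<le> 0" using True by simp
    ultimately show ?thesis by linarith
  qed
  then show ?thesis unfolding Let_def by (intro exI[of _ 1]) auto
next
  case False
  then have \<eta>: "0 < \<eta>" using assms(4) by simp
  \<comment> \<open>The second summand is the atom loss; the 1 absorbs the Chebyshev loss for large
    \<open>n\<close>.\<close>
  define C where "C = 1 + 2 / sqrt (\<epsilon> / 2) / \<eta>"
  have "0 \<le> 2 / sqrt (\<epsilon> / 2) / \<eta>" using \<eta> assms(2) by simp
  then have "0 < C" unfolding C_def by linarith
  moreover have "\<exists>N. \<forall>n\<ge>N. \<forall>p p' b0 b.
       (\<forall>i<n. \<epsilon> \<le> p i \<and> p i \<le> 1 - \<epsilon> \<and> \<epsilon> \<le> p' i \<and> p' i \<le> 1 - \<epsilon> \<and> \<bar>p i - p' i\<bar> \<ge> \<epsilon>) \<longrightarrow>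
       risk_minimizer n \<eta> p p' b0 b \<longrightarrow>
       (let V = (\<lambda>(x, y, z). Err (lin_pred n b0 b x) y) in
        toy_cond_prob n \<eta> p p' (\<lambda>(x, y, z). y * z = -1)
          (\<lambda>\<omega>. toy_cdf n \<eta> p p' V (V \<omega>) \<ge> 1 - \<theta>)
        \<ge> min 1 (\<eta> / \<theta>) - C / sqrt (real n))"
    if \<theta>: "0 < \<theta>" "\<theta> \<le> 1" for \<theta>
  proof -
    \<comment> \<open>The Chebyshev loss is \<open>K / n\<close>, which is at most
      \<open>1 / sqrt n\<close> once \<open>n\<close> reaches \<open>K\<^sup>2\<close>. Hence
      \<theta> influences only the threshold; taking \<open>Suc N\<close> there makes
      \<open>n\<close> positive.\<close>
    define K where "K = 2 / \<epsilon>\<^sup>2 / \<theta>"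
    obtain N where N: "K\<^sup>2 \<le> real N" using real_arch_simple by blast
    have "min 1 (\<eta> / \<theta>) - C / sqrt (real n) \<le> toy_cond_prob n \<eta> p p' (\<lambda>(x, y, z). y * z = -1)
          (\<lambda>\<omega>. toy_cdf n \<eta> p p' V (V \<omega>) \<ge> 1 - \<theta>)"
      if n: "Suc N \<le> n"
        and p: "\<And>i. i < n \<Longrightarrow> \<epsilon> \<le> p i \<and> p i \<le> 1 - \<epsilon> \<and> \<epsilon> \<le> p' i \<and> p' i \<le> 1 - \<epsilon> \<and> \<epsilon> \<le> \<bar>p i - p' i\<bar>"
        and min: "risk_minimizer n \<eta> p p' b0 b"
        and V: "V = (\<lambda>(x, y, z). Err (lin_pred n b0 b x) y)"
      for n p p' b0 b V
    proof -
      have n0: "0 < n" using n by simp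
      have "K\<^sup>2 \<le> real n" using N n by linarith
      then have "K \<le> sqrt (real n)" by (rule real_le_rsqrt)
      then have "K / real n \<le> sqrt (real n) / real n" by (rule divide_right_mono) simp
      also have "\<dots> = 1 / sqrt (real n)" using n0 by (simp add: field_simps)
      finally have "2 / \<epsilon>\<^sup>2 / real n / \<theta> \<le> 1 / sqrt (real n)" by (simp add: K_def mult_ac)
      moreover have "C / sqrt (real n) =
          1 / sqrt (real n) + 2 / sqrt (\<epsilon> / 2) / sqrt (real n) / \<eta>"
        unfolding C_def add_divide_distrib by (simp add: mult_ac)
      ultimately show ?thesis
        using toy_cond_prob_lower_bound[OF assms(2,3) \<eta> assms(5) n0 p min assms(1) \<theta> V]
        by linarith
    qed
    note bound = this
    show ?thesis
      unfolding Let_def by (intro exI[of _ "Suc N"] allI impI, rule bound) auto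
  qed
  ultimately show ?thesis by (intro exI[of _ C] conjI allI impI) auto
qed

end
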